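(* Let $T:V\to\mathfrak g$ be a relative Rota-Baxter operator on an $n$-LieRep pair $(\mathfrak g,[-,\cdots,-]_{\mathfrak g};\rho)$. There is a one-to-one correspondence between the space of equivalence classes of infinitesimal deformations of the relative Rota-Baxter operator $T$ and the first cohomology group $\mathcal H^1(V,\mathfrak g)$ of $T$.
   Context: All vector spaces are finite dimensional over an algebraically closed field $\mathbb K$ of characteristic $0$; $n\ge2$; a hat denotes omission. An $n$-Lie algebra is a vector space $\mathfrak g$ with a skew-symmetric linear map $[-,\cdots,-]_{\mathfrak g}:\wedge^n\mathfrak g\to\mathfrak g$ such that $[x_1,\cdots,x_{n-1},[y_1,\cdots,y_n]]=\sum_{i=1}^n[y_1,\cdots,y_{i-1},[x_1,\cdots,x_{n-1},y_i],y_{i+1},\cdots,y_n]$. For $\mathfrak X=x_1\wedge\cdots\wedge x_{n-1}$ write $\mathrm{ad}_{\mathfrak X}y=[\mathfrak X,y]_{\mathfrak g}=[x_1,\cdots,x_{n-1},y]_{\mathfrak g}$, extended linearly to $\mathfrak X\in\wedge^{n-1}\mathfrak g$. A representation of $\mathfrak g$ on $V$ is a linear map $\rho:\wedge^{n-1}\mathfrak g\to\mathfrak{gl}(V)$ with $[\rho(\mathfrak X),\rho(\mathfrak Y)]=\rho(\mathfrak X\circ\mathfrak Y)$ (commutator), where for $\mathfrak Y=y_1\wedge\cdots\wedge y_{n-1}$, $\mathfrak X\circ\mathfrak Y=\sum_{i=1}^{n-1}y_1\wedge\cdots\wedge[\mathfrak X,y_i]_{\mathfrak g}\wedge\cdots\wedge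 y_{n-1}$, and $\rho(x_1,\cdots,x_{n-2},[y_1,\cdots,y_n]_{\mathfrak g})=\sum_{i=1}^n(-1)^{n-i}\rho(y_1,\cdots,\widehat{y_i},\cdots,y_n)\rho(x_1,\cdots,x_{n-2},y_i)$. An $n$-LieRep pair is an $n$-Lie algebra with a representation $\rho$ on a vector space $V$. A relative Rota-Baxter operator on it is a linear map $T:V\to\mathfrak g$ with $[Tv_1,\cdots,Tv_n]_{\mathfrak g}=\sum_{i=1}^n(-1)^{n-i}T(\rho(Tv_1,\cdots,\widehat{Tv_i},\cdots,Tv_n)(v_i))$. Cohomology of $T$ in degree $1$: $V$ is an $n$-Lie algebra under $[u_1,\cdots,u_n]_T=\sum_{i=1}^n(-1)^{n-i}\rho(Tu_1,\cdots,\widehat{Tu_i},\cdots,Tu_n)(u_i)$, and $\rho_T:\wedge^{n-1}V\to\mathfrak{gl}(\mathfrak g)$, $\rho_T(u_1,\cdots,u_{n-1})x=[Tu_1,\cdots,Tu_{n-1},x]_{\mathfrak g}-\sum_{i=1}^{n-1}(-1)^{n-i}T\rho(Tu_1,\cdots,\widehat{Tu_i},\cdots,Tu_{n-1},x)(u_i)$ is a representation of it on $\mathfrak g$. The cochain complex begins with $C_T^0(V;\mathfrak g)=\wedge^{n-1}\mathfrak g$, $C_T^1(V;\mathfrak g)=\mathrm{Hom}(V,\mathfrak g)$, $C_T^2(V;\mathfrak g)=\mathrm{Hom}(\wedge^nV,\mathfrak g)$. The differential $d:C^0_T\to C^1_T$ is $(d\mathfrak X)(v)=T\rho(\mathfrak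 X)v-[\mathfrak X,Tv]_{\mathfrak g}$, and $d:C^1_T\to C^2_T$ is, for $\mathfrak U=u^1\wedge\cdots\wedge u^{n-1}$, $$(df)(\mathfrak U,v)=-f([u^1,\cdots,u^{n-1},v]_T)+\rho_T(\mathfrak U)f(v)+\sum_{i=1}^{n-1}(-1)^{n-i}\rho_T(u^1,\cdots,\widehat{u^i},\cdots,u^{n-1},v)f(u^i).$$ $\mathcal H^1(V,\mathfrak g)=\ker(d|_{C^1_T})/d(C^0_T)$. An infinitesimal deformation of $T$, denoted $(\mathfrak g,\mathfrak T_1)$, is a linear map $\mathfrak T_1:V\to\mathfrak g$ such that $T_t=T+t\mathfrak T_1$ satisfies $[T_tu_1,\cdots,T_tu_n]_{\mathfrak g}=T_t\big(\sum_{i=1}^n(-1)^{n-i}\rho(T_tu_1,\cdots,\widehat{T_tu_i},\cdots,T_tu_n)(u_i)\big)$ modulo $t^2$ (all structure maps extended $\mathbb K[t]/(t^2)$-multilinearly) for all $u_i\in V$. Two infinitesimal deformations $(\mathfrak g,\mathfrak T_1)$ and $(\mathfrak g,\mathfrak T_1')$ are equivalent if there exists $\mathfrak X\in\wedge^{n-1}\mathfrak g$ such that for $\phi_t=\mathrm{Id}_{\mathfrak g}+t\,\mathrm{ad}_{\mathfrak X}$ and $\varphi_t=\mathrm{Id}_V+t\rho(\mathfrak X)$, modulo $t^2$: (i) $[\phi_t(x_1),\cdots,\phi_t(x_n)]_{\mathfrak g}=\phi_t[x_1,\cdots,x_n]_{\mathfrak g}$; (ii) $\varphi_t\rho(x_1,\cdots,x_{n-1})(u)=\rho(\phi_t(x_1),\cdots,\phi_t(x_{n-1}))(\varphi_t(u))$;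 (iii) $T_t\circ\varphi_t=\phi_t\circ T_t'$, where $T_t=T+t\mathfrak T_1$, $T_t'=T+t\mathfrak T_1'$. *)

theory Defs
  imports
    "HOL-Computational_Algebra.Computational_Algebra"
    "HOL-Library.Poly_Mapping"
    "HOL-Library.Product_Plus"
begin

text \<open>
  A vector space is a whole type with a scalar multiplication (locale \<^locale>\<open>vector_space\<close>).
  An operation of \<open>n\<close> arguments takes a list; only its values on lists of length \<open>n\<close> matter.
  List positions are counted from 0, so the sign \<open>(-1)\<close> to the power \<open>n - i\<close> belonging to the
  \<open>i\<close>-th argument (counted from 1) appears as \<open>(-1) ^ (n - Suc i)\<close>.
\<close>

definition fin_dim_vector_space :: "('k::field \<Rightarrow> 'a::ab_group_add \<Rightarrow> 'a) \<Rightarrow> bool" where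
  "fin_dim_vector_space s \<longleftrightarrow> (\<exists>B. finite_dimensional_vector_space s B)"

definition omit :: "nat \<Rightarrow> 'a list \<Rightarrow> 'a list" where
  "omit i xs = take i xs @ drop (Suc i) xs"

text \<open>Linear maps out of the \<open>k\<close>-th exterior power, given by their values on decomposables.\<close>

definition alternating_multilinear ::
  "nat \<Rightarrow> ('k::field \<Rightarrow> 'a::ab_group_add \<Rightarrow> 'a) \<Rightarrow> ('k \<Rightarrow> 'b::ab_group_add \<Rightarrow> 'b) \<Rightarrow>
   ('a list \<Rightarrow> 'b) \<Rightarrow> bool" where
  "alternating_multilinear k s1 s2 f \<longleftrightarrow>
     (\<forall>xs i. length xs = k \<and> i < k \<longrightarrow> Vector_Spaces.linear s1 s2 (\<lambda>y. f (xs[i := y]))) \<and>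
     (\<forall>xs i j. length xs = k \<and> i < j \<and> j < k \<and> xs ! i = xs ! j \<longrightarrow> f xs = 0)"


subsection \<open>Exterior powers\<close>

text \<open>
  The \<open>k\<close>-th exterior power is the free vector space on the lists of length \<open>k\<close> modulo the
  subspace generated by the multilinearity and alternation relations. Its elements are cosets.
\<close>

definition free_scale :: "'k::field \<Rightarrow> ('a \<Rightarrow>\<^sub>0 'k) \<Rightarrow> ('a \<Rightarrow>\<^sub>0 'k)" where
  "free_scale c p = Poly_Mapping.map ((*) c) p"

definition free_lists :: "nat \<Rightarrow> ('a list \<Rightarrow>\<^sub>0 'k::field) set" where
  "free_lists k = {p. \<forall>xs \<in> Poly_Mapping.keys p. length xs = k}"

definition ext_relators ::
  "nat \<Rightarrow> ('k::field \<Rightarrow> 'a::ab_group_add \<Rightarrow> 'a) \<Rightarrow> ('a list \<Rightarrow>\<^sub>0 'k) set" where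
  "ext_relators k s =
     {Poly_Mapping.single (xs[i := a + b]) 1
        - Poly_Mapping.single (xs[i := a]) 1 - Poly_Mapping.single (xs[i := b]) 1
        | xs i a b. length xs = k \<and> i < k} \<union>
     {Poly_Mapping.single (xs[i := s c a]) 1 - Poly_Mapping.single (xs[i := a]) c
        | xs i c a. length xs = k \<and> i < k} \<union>
     {Poly_Mapping.single xs 1
        | xs i j. length xs = k \<and> i < j \<and> j < k \<and> xs ! i = xs ! j}"

definition ext_cong ::
  "nat \<Rightarrow> ('k::field \<Rightarrow> 'a::ab_group_add \<Rightarrow> 'a) \<Rightarrow> (('a list \<Rightarrow>\<^sub>0 'k) \<times> ('a list \<Rightarrow>\<^sub>0 'k)) set" where
  "ext_cong k s = {(p, q). p \<in> free_lists k \<and> q \<in> free_lists k \<and>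
                           p - q \<in> module.span free_scale (ext_relators k s)}"

definition ext_power ::
  "nat \<Rightarrow> ('k::field \<Rightarrow> 'a::ab_group_add \<Rightarrow> 'a) \<Rightarrow> ('a list \<Rightarrow>\<^sub>0 'k) set set" where
  "ext_power k s = free_lists k // ext_cong k s"

text \<open>
  The linear map on the exterior power induced by an alternating multilinear \<open>f\<close>; the linear
  extension of \<open>f\<close> to the free vector space is constant on every coset.
\<close>

definition free_lift :: "('k::field \<Rightarrow> 'b::ab_group_add \<Rightarrow> 'b) \<Rightarrow> ('a \<Rightarrow> 'b) \<Rightarrow> ('a \<Rightarrow>\<^sub>0 'k) \<Rightarrow> 'b" where
  "free_lift s f p = (\<Sum>x \<in> Poly_Mapping.keys p. s (Poly_Mapping.lookup p x) (f x))"

definition ext_lift ::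
  "('k::field \<Rightarrow> 'b::ab_group_add \<Rightarrow> 'b) \<Rightarrow> ('a list \<Rightarrow> 'b) \<Rightarrow> ('a list \<Rightarrow>\<^sub>0 'k) set \<Rightarrow> 'b" where
  "ext_lift s f X = the_elem (free_lift s f ` X)"


subsection \<open>Lie algebras with an \<open>n\<close>-ary bracket, representations, relative Rota-Baxter operators\<close>

definition n_lie_algebra ::
  "nat \<Rightarrow> ('k::field \<Rightarrow> 'g::ab_group_add \<Rightarrow> 'g) \<Rightarrow> ('g list \<Rightarrow> 'g) \<Rightarrow> bool" where
  "n_lie_algebra n sg br \<longleftrightarrow>
     alternating_multilinear n sg sg br \<and>
     (\<forall>xs ys. length xs = n - 1 \<and> length ys = n \<longrightarrow>
        br (xs @ [br ys]) = (\<Sum>i<n. br (ys[i := br (xs @ [ys ! i])])))"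

text \<open>\<open>rho xs v\<close> stands for \<open>\<rho>(x\<^sub>1, \<dots>, x\<^sub>n\<^sub>-\<^sub>1)(v)\<close>.\<close>

definition n_lie_representation ::
  "nat \<Rightarrow> ('k::field \<Rightarrow> 'g::ab_group_add \<Rightarrow> 'g) \<Rightarrow> ('k \<Rightarrow> 'v::ab_group_add \<Rightarrow> 'v) \<Rightarrow>
   ('g list \<Rightarrow> 'g) \<Rightarrow> ('g list \<Rightarrow> 'v \<Rightarrow> 'v) \<Rightarrow> bool" where
  "n_lie_representation n sg sv br rho \<longleftrightarrow>
     (\<forall>xs. length xs = n - 1 \<longrightarrow> Vector_Spaces.linear sv sv (rho xs)) \<and>
     (\<forall>v. alternating_multilinear (n - 1) sg sv (\<lambda>xs. rho xs v)) \<and>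
     (\<forall>xs ys v. length xs = n - 1 \<and> length ys = n - 1 \<longrightarrow>
        rho xs (rho ys v) - rho ys (rho xs v)
          = (\<Sum>i<n-1. rho (ys[i := br (xs @ [ys ! i])]) v)) \<and>
     (\<forall>xs ys v. length xs = n - 2 \<and> length ys = n \<longrightarrow>
        rho (xs @ [br ys]) v
          = (\<Sum>i<n. sv ((- 1) ^ (n - Suc i)) (rho (omit i ys) (rho (xs @ [ys ! i]) v))))"

definition n_lie_rep_pair ::
  "nat \<Rightarrow> ('k::field \<Rightarrow> 'g::ab_group_add \<Rightarrow> 'g) \<Rightarrow> ('k \<Rightarrow> 'v::ab_group_add \<Rightarrow> 'v) \<Rightarrow>
   ('g list \<Rightarrow> 'g) \<Rightarrow> ('g list \<Rightarrow> 'v \<Rightarrow> 'v) \<Rightarrow> bool" where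
  "n_lie_rep_pair n sg sv br rho \<longleftrightarrow>
     n_lie_algebra n sg br \<and> n_lie_representation n sg sv br rho"

definition relative_rota_baxter ::
  "nat \<Rightarrow> ('k::field \<Rightarrow> 'g::ab_group_add \<Rightarrow> 'g) \<Rightarrow> ('k \<Rightarrow> 'v::ab_group_add \<Rightarrow> 'v) \<Rightarrow>
   ('g list \<Rightarrow> 'g) \<Rightarrow> ('g list \<Rightarrow> 'v \<Rightarrow> 'v) \<Rightarrow> ('v \<Rightarrow> 'g) \<Rightarrow> bool" where
  "relative_rota_baxter n sg sv br rho T \<longleftrightarrow>
     Vector_Spaces.linear sv sg T \<and>
     (\<forall>vs. length vs = n \<longrightarrow>
        br (map T vs)
          = (\<Sum>i<n. sg ((- 1) ^ (n - Suc i)) (T (rho (map T (omit i vs)) (vs ! i)))))"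


subsection \<open>Cohomology in degree 1\<close>

definition rb_bracket ::
  "nat \<Rightarrow> ('k::field \<Rightarrow> 'v::ab_group_add \<Rightarrow> 'v) \<Rightarrow> ('g list \<Rightarrow> 'v \<Rightarrow> 'v) \<Rightarrow> ('v \<Rightarrow> 'g) \<Rightarrow>
   'v list \<Rightarrow> 'v" where
  "rb_bracket n sv rho T us
     = (\<Sum>i<n. sv ((- 1) ^ (n - Suc i)) (rho (map T (omit i us)) (us ! i)))"

definition rb_rho ::
  "nat \<Rightarrow> ('k::field \<Rightarrow> 'g::ab_group_add \<Rightarrow> 'g) \<Rightarrow> ('g list \<Rightarrow> 'g) \<Rightarrow> ('g list \<Rightarrow> 'v \<Rightarrow> 'v) \<Rightarrow>
   ('v \<Rightarrow> 'g) \<Rightarrow> 'v list \<Rightarrow> 'g \<Rightarrow> 'g" where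
  "rb_rho n sg br rho T us x
     = br (map T us @ [x])
       - (\<Sum>i<n-1. sg ((- 1) ^ (n - Suc i)) (T (rho (map T (omit i us) @ [x]) (us ! i))))"

definition ad_ext ::
  "('k::field \<Rightarrow> 'g::ab_group_add \<Rightarrow> 'g) \<Rightarrow> ('g list \<Rightarrow> 'g) \<Rightarrow> ('g list \<Rightarrow>\<^sub>0 'k) set \<Rightarrow> 'g \<Rightarrow> 'g" where
  "ad_ext sg br X y = ext_lift sg (\<lambda>xs. br (xs @ [y])) X"

definition rho_ext ::
  "('k::field \<Rightarrow> 'v::ab_group_add \<Rightarrow> 'v) \<Rightarrow> ('g list \<Rightarrow> 'v \<Rightarrow> 'v) \<Rightarrow> ('g list \<Rightarrow>\<^sub>0 'k) set \<Rightarrow> 'v \<Rightarrow> 'v" where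
  "rho_ext sv rho X v = ext_lift sv (\<lambda>xs. rho xs v) X"

definition d0 ::
  "('k::field \<Rightarrow> 'g::ab_group_add \<Rightarrow> 'g) \<Rightarrow> ('k \<Rightarrow> 'v::ab_group_add \<Rightarrow> 'v) \<Rightarrow>
   ('g list \<Rightarrow> 'g) \<Rightarrow> ('g list \<Rightarrow> 'v \<Rightarrow> 'v) \<Rightarrow> ('v \<Rightarrow> 'g) \<Rightarrow> ('g list \<Rightarrow>\<^sub>0 'k) set \<Rightarrow> 'v \<Rightarrow> 'g" where
  "d0 sg sv br rho T X v = T (rho_ext sv rho X v) - ad_ext sg br X (T v)"

definition d1 ::
  "nat \<Rightarrow> ('k::field \<Rightarrow> 'g::ab_group_add \<Rightarrow> 'g) \<Rightarrow> ('k \<Rightarrow> 'v::ab_group_add \<Rightarrow> 'v) \<Rightarrow>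
   ('g list \<Rightarrow> 'g) \<Rightarrow> ('g list \<Rightarrow> 'v \<Rightarrow> 'v) \<Rightarrow> ('v \<Rightarrow> 'g) \<Rightarrow> ('v \<Rightarrow> 'g) \<Rightarrow> 'v list \<Rightarrow> 'v \<Rightarrow> 'g" where
  "d1 n sg sv br rho T f us v
     = - f (rb_bracket n sv rho T (us @ [v]))
       + rb_rho n sg br rho T us (f v)
       + (\<Sum>i<n-1. sg ((- 1) ^ (n - Suc i)) (rb_rho n sg br rho T (omit i us @ [v]) (f (us ! i))))"

definition cocycles1 ::
  "nat \<Rightarrow> ('k::field \<Rightarrow> 'g::ab_group_add \<Rightarrow> 'g) \<Rightarrow> ('k \<Rightarrow> 'v::ab_group_add \<Rightarrow> 'v) \<Rightarrow>
   ('g list \<Rightarrow> 'g) \<Rightarrow> ('g list \<Rightarrow> 'v \<Rightarrow> 'v) \<Rightarrow> ('v \<Rightarrow> 'g) \<Rightarrow> ('v \<Rightarrow> 'g) set" where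
  "cocycles1 n sg sv br rho T =
     {f. Vector_Spaces.linear sv sg f \<and>
         (\<forall>us v. length us = n - 1 \<longrightarrow> d1 n sg sv br rho T f us v = 0)}"

definition coboundaries1 ::
  "nat \<Rightarrow> ('k::field \<Rightarrow> 'g::ab_group_add \<Rightarrow> 'g) \<Rightarrow> ('k \<Rightarrow> 'v::ab_group_add \<Rightarrow> 'v) \<Rightarrow>
   ('g list \<Rightarrow> 'g) \<Rightarrow> ('g list \<Rightarrow> 'v \<Rightarrow> 'v) \<Rightarrow> ('v \<Rightarrow> 'g) \<Rightarrow> ('v \<Rightarrow> 'g) set" where
  "coboundaries1 n sg sv br rho T = d0 sg sv br rho T ` ext_power (n - 1) sg"

definition cohomologous1 ::
  "nat \<Rightarrow> ('k::field \<Rightarrow> 'g::ab_group_add \<Rightarrow> 'g) \<Rightarrow> ('k \<Rightarrow> 'v::ab_group_add \<Rightarrow> 'v) \<Rightarrow>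
   ('g list \<Rightarrow> 'g) \<Rightarrow> ('g list \<Rightarrow> 'v \<Rightarrow> 'v) \<Rightarrow> ('v \<Rightarrow> 'g) \<Rightarrow> (('v \<Rightarrow> 'g) \<times> ('v \<Rightarrow> 'g)) set" where
  "cohomologous1 n sg sv br rho T =
     {(f, g). f \<in> cocycles1 n sg sv br rho T \<and> g \<in> cocycles1 n sg sv br rho T \<and>
              (\<lambda>v. f v - g v) \<in> coboundaries1 n sg sv br rho T}"

definition H1 ::
  "nat \<Rightarrow> ('k::field \<Rightarrow> 'g::ab_group_add \<Rightarrow> 'g) \<Rightarrow> ('k \<Rightarrow> 'v::ab_group_add \<Rightarrow> 'v) \<Rightarrow>
   ('g list \<Rightarrow> 'g) \<Rightarrow> ('g list \<Rightarrow> 'v \<Rightarrow> 'v) \<Rightarrow> ('v \<Rightarrow> 'g) \<Rightarrow> ('v \<Rightarrow> 'g) set set" where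
  "H1 n sg sv br rho T = cocycles1 n sg sv br rho T // cohomologous1 n sg sv br rho T"


subsection \<open>Extension of structure maps modulo \<open>t\<^sup>2\<close>\<close>

text \<open>
  The pair \<open>(a, b)\<close> stands for \<open>a + t b\<close> in \<open>W \<otimes> \<bbbK>[t]/(t\<^sup>2)\<close>. The functions below are the
  extensions that are multilinear over \<open>\<bbbK>[t]/(t\<^sup>2)\<close>:
  \<open>(f\<^sub>0 + t f\<^sub>1)(a + t b) = f\<^sub>0 a + t (f\<^sub>0 b + f\<^sub>1 a)\<close> for linear maps, and
  \<open>f(a\<^sub>1 + t b\<^sub>1, \<dots>, a\<^sub>k + t b\<^sub>k) = f(a\<^sub>1, \<dots>, a\<^sub>k) + t \<Sum>\<^sub>i f(a\<^sub>1, \<dots>, b\<^sub>i, \<dots>, a\<^sub>k)\<close> for multilinear \<open>f\<close>.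
\<close>

definition dual_const :: "'a \<Rightarrow> 'a \<times> 'a::zero" where
  "dual_const a = (a, 0)"

definition dual_scale :: "('k \<Rightarrow> 'a \<Rightarrow> 'a) \<Rightarrow> 'k \<Rightarrow> 'a \<times> 'a \<Rightarrow> 'a \<times> 'a" where
  "dual_scale s c = (\<lambda>(a, b). (s c a, s c b))"

definition dual_map :: "('a \<Rightarrow> 'b) \<Rightarrow> ('a \<Rightarrow> 'b) \<Rightarrow> 'a \<times> 'a \<Rightarrow> 'b \<times> 'b::ab_group_add" where
  "dual_map f0 f1 = (\<lambda>(a, b). (f0 a, f0 b + f1 a))"

definition dual_multi :: "('a list \<Rightarrow> 'b) \<Rightarrow> ('a \<times> 'a) list \<Rightarrow> 'b \<times> 'b::ab_group_add" where
  "dual_multi f xs =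
     (f (map fst xs), \<Sum>i<length xs. f ((map fst xs)[i := snd (xs ! i)]))"

definition dual_action ::
  "('g list \<Rightarrow> 'v \<Rightarrow> 'v) \<Rightarrow> ('g \<times> 'g) list \<Rightarrow> 'v \<times> 'v \<Rightarrow> 'v \<times> 'v::ab_group_add" where
  "dual_action rho xs = (\<lambda>(u, w).
     (rho (map fst xs) u,
      (\<Sum>i<length xs. rho ((map fst xs)[i := snd (xs ! i)]) u) + rho (map fst xs) w))"


subsection \<open>Infinitesimal deformations\<close>

definition infinitesimal_deformations ::
  "nat \<Rightarrow> ('k::field \<Rightarrow> 'g::ab_group_add \<Rightarrow> 'g) \<Rightarrow> ('k \<Rightarrow> 'v::ab_group_add \<Rightarrow> 'v) \<Rightarrow>
   ('g list \<Rightarrow> 'g) \<Rightarrow> ('g list \<Rightarrow> 'v \<Rightarrow> 'v) \<Rightarrow> ('v \<Rightarrow> 'g) \<Rightarrow> ('v \<Rightarrow> 'g) set" where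
  "infinitesimal_deformations n sg sv br rho T =
     {T1. Vector_Spaces.linear sv sg T1 \<and>
        (\<forall>us. length us = n \<longrightarrow>
           (let Tt = dual_map T T1; us' = map dual_const us in
            dual_multi br (map Tt us')
              = Tt (rb_bracket n (dual_scale sv) (dual_action rho) Tt us')))}"

definition deformation_equiv_via ::
  "nat \<Rightarrow> ('k::field \<Rightarrow> 'g::ab_group_add \<Rightarrow> 'g) \<Rightarrow> ('k \<Rightarrow> 'v::ab_group_add \<Rightarrow> 'v) \<Rightarrow>
   ('g list \<Rightarrow> 'g) \<Rightarrow> ('g list \<Rightarrow> 'v \<Rightarrow> 'v) \<Rightarrow> ('v \<Rightarrow> 'g) \<Rightarrow>
   ('g list \<Rightarrow>\<^sub>0 'k) set \<Rightarrow> ('v \<Rightarrow> 'g) \<Rightarrow> ('v \<Rightarrow> 'g) \<Rightarrow> bool" where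
  "deformation_equiv_via n sg sv br rho T X T1 T1' \<longleftrightarrow>
     (let phi = dual_map id (ad_ext sg br X); psi = dual_map id (rho_ext sv rho X) in
      (\<forall>xs. length xs = n \<longrightarrow>
         dual_multi br (map (phi \<circ> dual_const) xs) = phi (dual_const (br xs))) \<and>
      (\<forall>xs u. length xs = n - 1 \<longrightarrow>
         psi (dual_const (rho xs u))
           = dual_action rho (map (phi \<circ> dual_const) xs) (psi (dual_const u))) \<and>
      dual_map T T1 \<circ> psi = phi \<circ> dual_map T T1')"

definition deformation_equiv ::
  "nat \<Rightarrow> ('k::field \<Rightarrow> 'g::ab_group_add \<Rightarrow> 'g) \<Rightarrow> ('k \<Rightarrow> 'v::ab_group_add \<Rightarrow> 'v) \<Rightarrow>
   ('g list \<Rightarrow> 'g) \<Rightarrow> ('g list \<Rightarrow> 'v \<Rightarrow> 'v) \<Rightarrow> ('v \<Rightarrow> 'g) \<Rightarrow> (('v \<Rightarrow> 'g) \<times> ('v \<Rightarrow> 'g)) set" where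
  "deformation_equiv n sg sv br rho T =
     {(T1, T1'). T1 \<in> infinitesimal_deformations n sg sv br rho T \<and>
                 T1' \<in> infinitesimal_deformations n sg sv br rho T \<and>
                 (\<exists>X \<in> ext_power (n - 1) sg. deformation_equiv_via n sg sv br rho T X T1 T1')}"

end

theory Submission
  imports Defs
begin

text \<open>
  The two quotients are literally the same: both the underlying sets and the equivalence relations
  agree, so the correspondence is the identity.

  An infinitesimal deformation is a 1-cocycle and conversely
  (\<open>infinitesimal_deformations_eq_cocycles1\<close>): the constant term of the deformation equation is the
  relative Rota-Baxter identity for \<open>T\<close>, and its coefficient at \<open>t\<close> is the cocycle equation
  \<open>d f = 0\<close>. To compare the two, every argument \<open>f(u\<^sub>i)\<close> inside the bracket or inside \<open>\<rho>\<close> is moved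
  to the last position, which costs a sign (\<open>alternating_move_last\<close>), and the double sum over
  ordered pairs of distinct positions is reindexed by exchanging the two positions
  (\<open>sum_swap_positions\<close>).

  Two deformations are equivalent if and only if they differ by a coboundary
  (\<open>deformation_equiv_eq_cohomologous1\<close>): for every \<open>X\<close> in the exterior power, the first two
  conditions on \<open>\<phi>\<^sub>t = Id + t ad\<^sub>X\<close> and \<open>\<psi>\<^sub>t = Id + t \<rho>(X)\<close> hold automatically, since modulo
  \<open>t\<^sup>2\<close> they say that \<open>ad\<^sub>X\<close> is a derivation of the bracket and that
  \<open>[\<rho>(X), \<rho>(Y)] = \<rho>(X \<circ> Y)\<close> (\<open>ad_ext_derivation\<close>, \<open>rho_ext_commutator\<close>). The third one reads
  \<open>T1 - T1' = - d X\<close>, and the coboundaries are closed under negation.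
\<close>


section \<open>Lists and reindexing of double sums\<close>

lemma length_omit: "i < length xs \<Longrightarrow> length (omit i xs) = length xs - 1"
  by (auto simp: omit_def)

lemma map_omit: "map f (omit i xs) = omit i (map f xs)"
  by (simp add: omit_def take_map drop_map)

lemma omit_append_left: "i < length xs \<Longrightarrow> omit i (xs @ ys) = omit i xs @ ys"
  by (simp add: omit_def)

lemma omit_last: "omit (length xs) (xs @ [y]) = xs"
  by (simp add: omit_def)

text \<open>
  Position \<open>j\<close> of a list from which position \<open>m\<close> has been removed is position \<open>unomit m j\<close> of the
  original list; \<open>omitted_pos m j\<close> is the position of the original entry \<open>m\<close> after
  position \<open>unomit m j\<close> has been removed instead.
\<close>

definition unomit :: "nat \<Rightarrow> nat \<Rightarrow> nat" where
  "unomit m j = (if j < m then j else Suc j)"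

definition omitted_pos :: "nat \<Rightarrow> nat \<Rightarrow> nat" where
  "omitted_pos m j = (if j < m then m - 1 else m)"

lemma nth_omit:
  assumes "i < length xs" "j < length xs - 1"
  shows "omit i xs ! j = xs ! unomit i j"
  using assms by (auto simp: omit_def unomit_def nth_append min_def)

lemma unomit_omitted_pos:
  "unomit (unomit m j) (omitted_pos m j) = m"
  "omitted_pos (unomit m j) (omitted_pos m j) = j"
  by (auto simp: unomit_def omitted_pos_def)

lemma unomit_less:
  assumes "m < Suc N" "j < N"
  shows "unomit m j < Suc N" "omitted_pos m j < N"
  using assms by (auto simp: unomit_def omitted_pos_def)

lemma omit_omit:
  assumes "length xs = Suc N" "m < Suc N" "j < N"
  shows "omit (omitted_pos m j) (omit (unomit m j) xs) = omit j (omit m xs)"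
proof (rule nth_equalityI)
  have l: "length (omit m xs) = N" "length (omit (unomit m j) xs) = N"
    using assms unomit_less[OF assms(2,3)] by (simp_all add: length_omit)
  then show "length (omit (omitted_pos m j) (omit (unomit m j) xs)) = length (omit j (omit m xs))"
    using assms unomit_less[OF assms(2,3)] by (simp add: length_omit)
  fix i assume "i < length (omit (omitted_pos m j) (omit (unomit m j) xs))"
  then have i: "i < N - 1" using l unomit_less[OF assms(2,3)] by (simp add: length_omit)
  have "unomit j i < N" "unomit (omitted_pos m j) i < N"
    using i assms by (auto simp: unomit_def)
  moreover have "unomit (unomit m j) (unomit (omitted_pos m j) i) = unomit m (unomit j i)"
    by (auto simp: unomit_def omitted_pos_def)
  ultimately show "omit (omitted_pos m j) (omit (unomit m j) xs) ! i = omit j (omit m xs) ! i"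
    using assms unomit_less[OF assms(2,3)] i l by (simp add: nth_omit)
qed

text \<open>The pairs \<open>(m, j)\<close> encode the ordered pairs of distinct positions \<open>(m, unomit m j)\<close>.\<close>

lemma sum_swap_positions:
  fixes F :: "nat \<Rightarrow> nat \<Rightarrow> 'a::comm_monoid_add"
  shows "(\<Sum>m<Suc N. \<Sum>j<N. F m j) = (\<Sum>m<Suc N. \<Sum>j<N. F (unomit m j) (omitted_pos m j))"
  unfolding sum.cartesian_product
  by (rule sum.reindex_bij_witness[where
        i = "\<lambda>(m, j). (unomit m j, omitted_pos m j)" and
        j = "\<lambda>(m, j). (unomit m j, omitted_pos m j)"])
     (auto simp: unomit_omitted_pos simp del: lessThan_Suc intro: unomit_less)

lemma minus_one_power_swap:
  assumes "m < Suc N" "j < N"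
  shows "(- 1) ^ (N - unomit m j) * (- 1) ^ (N - omitted_pos m j)
           = ((- 1) ^ (N - m) * (- 1) ^ (N - Suc j) :: 'a::comm_ring_1)"
proof (cases "j < m")
  case True
  then have "N - omitted_pos m j = Suc (N - m)" "N - unomit m j = Suc (N - Suc j)"
    using assms by (auto simp: unomit_def omitted_pos_def)
  then show ?thesis by (simp add: mult.commute)
next
  case False
  then have "N - omitted_pos m j = N - m" "N - unomit m j = N - Suc j"
    using assms by (auto simp: unomit_def omitted_pos_def)
  then show ?thesis by (simp add: mult.commute)
qed


section \<open>Alternating multilinear maps\<close>

lemma alternating_multilinearD:
  assumes "alternating_multilinear k s1 s2 f"
  shows "length xs = k \<Longrightarrow> i < k \<Longrightarrow> Vector_Spaces.linear s1 s2 (\<lambda>y. f (xs[i := y]))"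
    and "length xs = k \<Longrightarrow> i < j \<Longrightarrow> j < k \<Longrightarrow> xs ! i = xs ! j \<Longrightarrow> f xs = 0"
  using assms unfolding alternating_multilinear_def by blast+

lemma linear_simps:
  assumes "Vector_Spaces.linear s1 s2 f"
  shows "f (x + y) = f x + f y" "f (x - y) = f x - f y" "f (- x) = - f x" "f 0 = 0"
    "f (s1 c x) = s2 c (f x)" "f (sum h A) = (\<Sum>a\<in>A. f (h a))"
proof -
  interpret L: Vector_Spaces.linear s1 s2 f by fact
  show "f (x + y) = f x + f y" "f (x - y) = f x - f y" "f (- x) = - f x" "f 0 = 0"
    "f (s1 c x) = s2 c (f x)" "f (sum h A) = (\<Sum>a\<in>A. f (h a))"
    by (simp_all add: L.add L.diff L.neg L.zero L.scale L.sum)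
qed

lemma alternating_swap_adjacent:
  assumes f: "alternating_multilinear k s1 s2 f" and k: "length (as @ x # y # bs) = k"
  shows "f (as @ x # y # bs) = - f (as @ y # x # bs)"
proof -
  let ?F = "\<lambda>x y. f (as @ x # y # bs)"
  have diag: "?F z z = 0" for z
    using k by (intro alternating_multilinearD(2)[OF f, where i = "length as" and j = "Suc (length as)"])
      (auto simp: nth_append)
  have l1: "?F (a + b) y = ?F a y + ?F b y" for a b y
    using linear_simps(1)[OF alternating_multilinearD(1)[OF f, of "as @ a # y # bs" "length as"]] k
    by (simp add: list_update_append)
  have l2: "?F x (a + b) = ?F x a + ?F x b" for x a b
    using linear_simps(1)[OF alternating_multilinearD(1)[OF f, of "as @ x # a # bs" "Suc (length as)"]] k
    by (simp add: list_update_append)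
  have "0 = ?F (x + y) (x + y)" by (simp add: diag)
  also have "\<dots> = ?F x y + ?F y x" unfolding l1 l2 by (simp add: diag)
  finally show ?thesis by (simp add: eq_neg_iff_add_eq_0)
qed

lemma alternating_cycle:
  assumes f: "alternating_multilinear k s1 s2 f" and s2: "vector_space s2"
    and k: "length (as @ y # bs) = k"
  shows "f (as @ y # bs) = s2 ((- 1) ^ length bs) (f (as @ bs @ [y]))"
  using k
proof (induction bs arbitrary: as)
  case Nil
  interpret vector_space s2 by fact
  show ?case by simp
next
  case (Cons b bs)
  interpret vector_space s2 by fact
  have "f (as @ y # b # bs) = - f ((as @ [b]) @ y # bs)"
    using alternating_swap_adjacent[OF f Cons.prems] by simp
  also have "\<dots> = - s2 ((- 1) ^ length bs) (f ((as @ [b]) @ bs @ [y]))"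
    using Cons.IH[of "as @ [b]"] Cons.prems by simp
  finally show ?case by (simp add: scale_minus_left)
qed

lemma alternating_move_last:
  assumes f: "alternating_multilinear k s1 s2 f" and s2: "vector_space s2"
    and k: "length xs = k" "i < k"
  shows "f (xs[i := y]) = s2 ((- 1) ^ (k - Suc i)) (f (omit i xs @ [y]))"
  using alternating_cycle[OF f s2, of "take i xs" y "drop (Suc i) xs"] k
  by (simp add: upd_conv_take_nth_drop omit_def)

lemma alternating_fix_last:
  fixes f :: "'a::ab_group_add list \<Rightarrow> 'b::ab_group_add"
  assumes f: "alternating_multilinear (Suc k) s1 s2 f"
  shows "alternating_multilinear k s1 s2 (\<lambda>xs. f (xs @ [y]))"
  unfolding alternating_multilinear_def
proof (intro conjI allI impI; elim conjE)
  fix xs :: "'a list" and i assume "length xs = k" "i < k"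
  then show "Vector_Spaces.linear s1 s2 (\<lambda>z. f (xs[i := z] @ [y]))"
    using alternating_multilinearD(1)[OF f, of "xs @ [y]" i] by (simp add: list_update_append)
next
  fix xs :: "'a list" and i j
  assume "length xs = k" "i < j" "j < k" "xs ! i = xs ! j"
  then show "f (xs @ [y]) = 0"
    by (intro alternating_multilinearD(2)[OF f, of _ i j]) (auto simp: nth_append)
qed


section \<open>Linear maps on the exterior power\<close>

lemma lookup_free_scale: "Poly_Mapping.lookup (free_scale c p) x = c * Poly_Mapping.lookup p x"
  by (simp add: free_scale_def map.rep_eq when_def)

lemma vector_space_free_scale: "vector_space (free_scale :: 'k::field \<Rightarrow> _)"
  by unfold_locales
    (auto intro!: poly_mapping_eqI simp: lookup_free_scale lookup_add algebra_simps)

lemma free_lift_superset: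
  assumes "vector_space s" "finite A" "Poly_Mapping.keys p \<subseteq> A"
  shows "free_lift s f p = (\<Sum>x\<in>A. s (Poly_Mapping.lookup p x) (f x))"
proof -
  interpret vector_space s by fact
  show ?thesis unfolding free_lift_def
    using assms(2,3) by (intro sum.mono_neutral_left) (auto simp: in_keys_iff)
qed

lemma linear_free_lift:
  assumes "vector_space s"
  shows "Vector_Spaces.linear free_scale s (free_lift s f)"
proof -
  interpret vector_space s by fact
  interpret F: vector_space "free_scale :: 'a \<Rightarrow> ('c \<Rightarrow>\<^sub>0 'a) \<Rightarrow> _"
    by (rule vector_space_free_scale)
  show ?thesis
  proof unfold_locales
    fix p q :: "'c \<Rightarrow>\<^sub>0 'a"
    let ?A = "Poly_Mapping.keys p \<union> Poly_Mapping.keys q"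
    have "Poly_Mapping.keys (p + q) \<subseteq> ?A" by (rule Poly_Mapping.keys_add)
    then show "free_lift s f (p + q) = free_lift s f p + free_lift s f q"
      by (simp add: free_lift_superset[OF assms, of ?A] lookup_add scale_left_distrib sum.distrib)
  next
    fix c and p :: "'c \<Rightarrow>\<^sub>0 'a"
    have "Poly_Mapping.keys (free_scale c p) \<subseteq> Poly_Mapping.keys p"
      by (auto simp: in_keys_iff lookup_free_scale)
    then show "free_lift s f (free_scale c p) = s c (free_lift s f p)"
      by (simp add: free_lift_superset[OF assms, of "Poly_Mapping.keys p"] lookup_free_scale
          scale_sum_right)
  qed
qed

lemma free_lift_single:
  assumes "vector_space s"
  shows "free_lift s f (Poly_Mapping.single x c) = s c (f x)"
proof -
  interpret vector_space s by fact
  show ?thesis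
    using free_lift_superset[OF assms, of "{x}" "Poly_Mapping.single x c" f] by simp
qed

lemma free_lift_relators:
  assumes f: "alternating_multilinear k s1 s f" and s: "vector_space s"
    and p: "p \<in> module.span free_scale (ext_relators k s1)"
  shows "free_lift s f p = 0"
proof -
  interpret S: vector_space s by fact
  interpret L: Vector_Spaces.linear free_scale s "free_lift s f"
    by (rule linear_free_lift[OF s])
  have "free_lift s f r = 0" if "r \<in> ext_relators k s1" for r
    using that unfolding ext_relators_def
    by (auto simp: L.diff free_lift_single[OF s] linear_simps(1,5)[OF alternating_multilinearD(1)[OF f]]
        intro: alternating_multilinearD(2)[OF f])
  then show ?thesis by (rule L.eq_0_on_span) (use p in auto)
qed

text \<open>The lift to the exterior power can be computed on any representative of a coset.\<close>

lemma ext_lift_class: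
  fixes f :: "'a::ab_group_add list \<Rightarrow> 'b::ab_group_add" and p :: "'a list \<Rightarrow>\<^sub>0 'k::field"
  assumes f: "alternating_multilinear k s1 s f" and s: "vector_space s"
    and p: "p \<in> free_lists k"
  shows "ext_lift s f (ext_cong k s1 `` {p}) = free_lift s f p"
proof -
  interpret F: vector_space "free_scale :: 'k \<Rightarrow> ('a list \<Rightarrow>\<^sub>0 'k) \<Rightarrow> _"
    by (rule vector_space_free_scale)
  interpret L: Vector_Spaces.linear free_scale s "free_lift s f"
    by (rule linear_free_lift[OF s])
  have "p \<in> ext_cong k s1 `` {p}" using p by (simp add: ext_cong_def F.span_zero)
  moreover have "free_lift s f q = free_lift s f p" if "q \<in> ext_cong k s1 `` {p}" for q
    using that free_lift_relators[OF f s, of "p - q"] by (simp add: ext_cong_def L.diff)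
  ultimately have "free_lift s f ` (ext_cong k s1 `` {p}) = {free_lift s f p}" by blast
  then show ?thesis by (simp add: ext_lift_def)
qed

lemma free_lists_closed:
  "0 \<in> free_lists k"
  "p \<in> free_lists k \<Longrightarrow> - p \<in> free_lists k"
  "p \<in> free_lists k \<Longrightarrow> q \<in> free_lists k \<Longrightarrow> p + q \<in> free_lists k"
  using Poly_Mapping.keys_add[of p q] by (auto simp: free_lists_def)

lemma ext_powerE:
  assumes "X \<in> ext_power k s"
  obtains p where "p \<in> free_lists k" "X = ext_cong k s `` {p}"
  using assms unfolding ext_power_def by (rule quotientE)

lemma ext_power_class: "p \<in> free_lists k \<Longrightarrow> ext_cong k s `` {p} \<in> ext_power k s"
  unfolding ext_power_def by (rule quotientI)


section \<open>Relative Rota-Baxter operators\<close>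

text \<open>
  A relative Rota-Baxter operator on vector spaces of any dimension. The arity is \<open>Suc N\<close>, so that
  \<open>\<rho>\<close> and the exterior power have degree \<open>N\<close>.
\<close>

locale rota_baxter_operator =
  G: vector_space sg + V: vector_space sv
  for sg :: "'k::field \<Rightarrow> 'g::ab_group_add \<Rightarrow> 'g"
    and sv :: "'k \<Rightarrow> 'v::ab_group_add \<Rightarrow> 'v" +
  fixes N :: nat
    and br :: "'g list \<Rightarrow> 'g"
    and rho :: "'g list \<Rightarrow> 'v \<Rightarrow> 'v"
    and T :: "'v \<Rightarrow> 'g"
  assumes pair: "n_lie_rep_pair (Suc N) sg sv br rho"
    and rota_baxter: "relative_rota_baxter (Suc N) sg sv br rho T"
begin

lemma br_alternating: "alternating_multilinear (Suc N) sg sg br"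
  and br_fundamental: "length xs = N \<Longrightarrow> length ys = Suc N \<Longrightarrow>
        br (xs @ [br ys]) = (\<Sum>i<Suc N. br (ys[i := br (xs @ [ys ! i])]))"
  using pair unfolding n_lie_rep_pair_def n_lie_algebra_def by auto

lemma rho_linear: "length xs = N \<Longrightarrow> Vector_Spaces.linear sv sv (rho xs)"
  and rho_alternating: "alternating_multilinear N sg sv (\<lambda>xs. rho xs v)"
  and rho_commutator: "length xs = N \<Longrightarrow> length ys = N \<Longrightarrow>
        rho xs (rho ys v) - rho ys (rho xs v) = (\<Sum>i<N. rho (ys[i := br (xs @ [ys ! i])]) v)"
  using pair unfolding n_lie_rep_pair_def n_lie_representation_def by auto

lemma T_linear: "Vector_Spaces.linear sv sg T"
  and T_rota_baxter: "length vs = Suc N \<Longrightarrow> br (map T vs) = T (rb_bracket (Suc N) sv rho T vs)"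
  using rota_baxter unfolding relative_rota_baxter_def rb_bracket_def
  by (auto simp: linear_simps[of sv sg T] simp del: sum.lessThan_Suc)

lemmas T_simps = linear_simps[OF T_linear]


section \<open>Infinitesimal deformations are cocycles\<close>

lemma d1_conv_sum:
  assumes "length us = N"
  shows "d1 (Suc N) sg sv br rho T f us v
    = - f (rb_bracket (Suc N) sv rho T (us @ [v]))
      + (\<Sum>m<Suc N. sg ((- 1) ^ (N - m))
           (rb_rho (Suc N) sg br rho T (omit m (us @ [v])) (f ((us @ [v]) ! m))))"
  using assms omit_last[of us v]
  by (simp add: d1_def nth_append omit_append_left algebra_simps)

lemma br_move_last:
  "length xs = Suc N \<Longrightarrow> m < Suc N \<Longrightarrow> sg ((- 1) ^ (N - m)) (br (omit m xs @ [y])) = br (xs[m := y])"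
  using alternating_move_last[OF br_alternating G.vector_space_axioms, of xs m y] by simp

lemma rho_move_last:
  assumes "length xs = N" "j < N"
  shows "rho (xs[j := y]) v = sv ((- 1) ^ (N - Suc j)) (rho (omit j xs @ [y]) v)"
  using alternating_move_last[OF rho_alternating V.vector_space_axioms assms] .

text \<open>
  The left side carries \<open>f w\<^sub>m\<close> in the last argument of \<open>\<rho>\<close> and acts on the remaining \<open>w\<^sub>k\<close>; the
  right side removes \<open>w\<^sub>k\<close> first and replaces \<open>T w\<^sub>m\<close> by \<open>f w\<^sub>m\<close> in its original position.
\<close>

lemma rho_double_sum:
  assumes w: "length w = Suc N"
  shows "(\<Sum>m<Suc N. \<Sum>j<N. sv ((- 1) ^ (N - m) * (- 1) ^ (N - j))
            (rho (map T (omit j (omit m w)) @ [f (w ! m)]) (omit m w ! j)))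
    = (\<Sum>k<Suc N. sv ((- 1) ^ (N - k))
            (\<Sum>j<N. rho ((map T (omit k w))[j := f (omit k w ! j)]) (w ! k)))"
    (is "?L = ?R")
proof -
  define F where "F m j = sv ((- 1) ^ (N - m) * (- 1) ^ (N - j))
    (rho (map T (omit j (omit m w)) @ [f (w ! m)]) (omit m w ! j))" for m j
  have F: "F (unomit m j) (omitted_pos m j)
      = sv ((- 1) ^ (N - m)) (rho ((map T (omit m w))[j := f (omit m w ! j)]) (w ! m))"
    if mj: "m < Suc N" "j < N" for m j
  proof -
    note less = unomit_less[OF mj]
    have "omit (unomit m j) w ! omitted_pos m j = w ! m"
      using less w by (simp add: nth_omit unomit_omitted_pos)
    moreover have "w ! unomit m j = omit m w ! j"
      using mj w by (simp add: nth_omit)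
    ultimately have "F (unomit m j) (omitted_pos m j)
      = sv ((- 1) ^ (N - m) * (- 1) ^ (N - Suc j))
          (rho (map T (omit j (omit m w)) @ [f (omit m w ! j)]) (w ! m))"
      unfolding F_def by (simp add: omit_omit[OF w mj] minus_one_power_swap[OF mj])
    also have "\<dots> = sv ((- 1) ^ (N - m)) (rho ((map T (omit m w))[j := f (omit m w ! j)]) (w ! m))"
      using mj w by (subst rho_move_last) (simp_all add: length_omit map_omit)
    finally show ?thesis .
  qed
  have "?L = (\<Sum>m<Suc N. \<Sum>j<N. F m j)" by (simp add: F_def)
  also have "\<dots> = (\<Sum>m<Suc N. \<Sum>j<N. F (unomit m j) (omitted_pos m j))"
    by (rule sum_swap_positions)
  also have "\<dots> = ?R"
    unfolding V.scale_sum_right by (intro sum.cong refl F) auto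
  finally show ?thesis .
qed

text \<open>
  The right side is the coefficient at \<open>t\<close> of the difference of the two sides of the deformation
  equation for \<open>T + t f\<close>.
\<close>

lemma d1_eq_deformation_defect:
  fixes v :: 'v
  assumes us: "length us = N"
  defines "w \<equiv> us @ [v]"
  shows "d1 (Suc N) sg sv br rho T f us v
    = (\<Sum>m<Suc N. br ((map T w)[m := f (w ! m)]))
      - (T (\<Sum>k<Suc N. sv ((- 1) ^ (N - k))
              (\<Sum>j<N. rho ((map T (omit k w))[j := f (omit k w ! j)]) (w ! k)))
         + f (rb_bracket (Suc N) sv rho T w))"
proof -
  have w: "length w = Suc N" using us by (simp add: w_def)
  have "(\<Sum>m<Suc N. sg ((- 1) ^ (N - m)) (rb_rho (Suc N) sg br rho T (omit m w) (f (w ! m))))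
    = (\<Sum>m<Suc N. br ((map T w)[m := f (w ! m)]))
      - T (\<Sum>m<Suc N. \<Sum>j<N. sv ((- 1) ^ (N - m) * (- 1) ^ (N - j))
            (rho (map T (omit j (omit m w)) @ [f (w ! m)]) (omit m w ! j)))"
    unfolding T_simps sum_subtractf[symmetric]
  proof (intro sum.cong refl)
    fix m assume "m \<in> {..<Suc N}"
    then have "br ((map T w)[m := f (w ! m)])
        = sg ((- 1) ^ (N - m)) (br (map T (omit m w) @ [f (w ! m)]))"
      using w by (simp add: br_move_last map_omit)
    then show "sg ((- 1) ^ (N - m)) (rb_rho (Suc N) sg br rho T (omit m w) (f (w ! m)))
      = br ((map T w)[m := f (w ! m)])
        - (\<Sum>j<N. sg ((- 1) ^ (N - m) * (- 1) ^ (N - j))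
            (T (rho (map T (omit j (omit m w)) @ [f (w ! m)]) (omit m w ! j))))"
      by (simp add: rb_rho_def G.scale_right_diff_distrib G.scale_sum_right)
  qed
  then show ?thesis
    unfolding d1_conv_sum[OF us] w_def[symmetric] rho_double_sum[OF w] by simp
qed

lemma deformation_equation_iff:
  assumes f: "Vector_Spaces.linear sv sg f" and w: "length w = Suc N"
  shows "dual_multi br (map (dual_map T f) (map dual_const w))
      = dual_map T f (rb_bracket (Suc N) (dual_scale sv) (dual_action rho) (dual_map T f)
          (map dual_const w))
    \<longleftrightarrow> d1 (Suc N) sg sv br rho T f (butlast w) (last w) = 0"
proof -
  have Tt: "dual_map T f (dual_const u) = (T u, f u)" for u
    by (simp add: dual_map_def dual_const_def T_simps)
  have L: "dual_multi br (map (dual_map T f) (map dual_const w))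
      = (br (map T w), \<Sum>m<Suc N. br ((map T w)[m := f (w ! m)]))"
    using w by (auto simp: dual_multi_def Tt o_def simp del: sum.lessThan_Suc intro!: sum.cong)
  have act: "dual_action rho (map (dual_map T f) (omit i (map dual_const w))) (map dual_const w ! i)
    = (rho (map T (omit i w)) (w ! i),
       \<Sum>j<N. rho ((map T (omit i w))[j := f (omit i w ! j)]) (w ! i))" if i: "i < Suc N" for i
  proof -
    have "length (omit i w) = N" using w i by (simp add: length_omit)
    moreover from this have "rho (map T (omit i w)) 0 = 0"
      by (intro linear_simps(4)[OF rho_linear]) simp
    moreover have "map dual_const w ! i = (w ! i, 0)" using w i by (simp add: dual_const_def)
    ultimately show ?thesis
      by (auto simp: dual_action_def Tt o_def map_omit[symmetric] intro!: sum.cong)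
  qed
  have "rb_bracket (Suc N) (dual_scale sv) (dual_action rho) (dual_map T f) (map dual_const w)
      = (rb_bracket (Suc N) sv rho T w,
         \<Sum>k<Suc N. sv ((- 1) ^ (N - k))
            (\<Sum>j<N. rho ((map T (omit k w))[j := f (omit k w ! j)]) (w ! k)))"
    unfolding rb_bracket_def
    by (simp add: act dual_scale_def sum_prod del: sum.lessThan_Suc)
  then have R: "dual_map T f (rb_bracket (Suc N) (dual_scale sv) (dual_action rho) (dual_map T f)
          (map dual_const w))
    = (T (rb_bracket (Suc N) sv rho T w),
       T (\<Sum>k<Suc N. sv ((- 1) ^ (N - k))
            (\<Sum>j<N. rho ((map T (omit k w))[j := f (omit k w ! j)]) (w ! k)))
       + f (rb_bracket (Suc N) sv rho T w))"
    by (simp add: dual_map_def del: sum.lessThan_Suc)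
  have "w \<noteq> []" using w by auto
  then have "butlast w @ [last w] = w" by simp
  then show ?thesis
    unfolding L R using d1_eq_deformation_defect[of "butlast w" f "last w"] w
    by (simp add: T_rota_baxter del: sum.lessThan_Suc)
qed

lemma infinitesimal_deformations_eq_cocycles1:
  "infinitesimal_deformations (Suc N) sg sv br rho T = cocycles1 (Suc N) sg sv br rho T"
proof -
  have lists: "(\<forall>w. length w = Suc N \<longrightarrow> P (butlast w) (last w))
      \<longleftrightarrow> (\<forall>us v. length us = Suc N - 1 \<longrightarrow> P us v)" for P :: "'v list \<Rightarrow> 'v \<Rightarrow> bool"
  proof (intro iffI allI impI)
    fix us :: "'v list" and v
    assume "\<forall>w. length w = Suc N \<longrightarrow> P (butlast w) (last w)" "length us = Suc N - 1"
    then show "P us v" by (auto dest: spec[of _ "us @ [v]"])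
  qed simp
  show ?thesis
    unfolding infinitesimal_deformations_def cocycles1_def Let_def lists[symmetric]
    by (intro Collect_cong conj_cong refl) (simp add: deformation_equation_iff del: map_map)
qed


section \<open>Equivalence of deformations is cohomology\<close>

lemma ad_ext_class:
  "p \<in> free_lists N \<Longrightarrow>
    ad_ext sg br (ext_cong N sg `` {p}) y = free_lift sg (\<lambda>xs. br (xs @ [y])) p"
  unfolding ad_ext_def
  by (rule ext_lift_class[OF alternating_fix_last[OF br_alternating] G.vector_space_axioms])

lemma rho_ext_class:
  "p \<in> free_lists N \<Longrightarrow>
    rho_ext sv rho (ext_cong N sg `` {p}) v = free_lift sv (\<lambda>xs. rho xs v) p"
  unfolding rho_ext_def
  by (rule ext_lift_class[OF rho_alternating V.vector_space_axioms])

lemma ad_ext_derivation: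
  assumes X: "X \<in> ext_power N sg" and ys: "length ys = Suc N"
  shows "(\<Sum>i<Suc N. br (ys[i := ad_ext sg br X (ys ! i)])) = ad_ext sg br X (br ys)"
proof -
  obtain p where p: "p \<in> free_lists N" and X: "X = ext_cong N sg `` {p}"
    using X by (rule ext_powerE)
  let ?K = "Poly_Mapping.keys p" and ?c = "Poly_Mapping.lookup p"
  have "(\<Sum>i<Suc N. br (ys[i := ad_ext sg br X (ys ! i)]))
      = (\<Sum>i<Suc N. \<Sum>xs\<in>?K. sg (?c xs) (br (ys[i := br (xs @ [ys ! i])])))"
    unfolding X ad_ext_class[OF p] free_lift_def
    by (intro sum.cong refl)
      (simp add: linear_simps(5,6)[OF alternating_multilinearD(1)[OF br_alternating ys]])
  also have "\<dots> = (\<Sum>xs\<in>?K. sg (?c xs) (\<Sum>i<Suc N. br (ys[i := br (xs @ [ys ! i])])))"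
    unfolding G.scale_sum_right by (rule sum.swap)
  also have "\<dots> = (\<Sum>xs\<in>?K. sg (?c xs) (br (xs @ [br ys])))"
    using p ys by (intro sum.cong refl) (simp add: br_fundamental free_lists_def del: sum.lessThan_Suc)
  finally show ?thesis unfolding X ad_ext_class[OF p] free_lift_def .
qed

lemma rho_ext_commutator:
  assumes X: "X \<in> ext_power N sg" and ys: "length ys = N"
  shows "rho_ext sv rho X (rho ys v)
    = (\<Sum>i<N. rho (ys[i := ad_ext sg br X (ys ! i)]) v) + rho ys (rho_ext sv rho X v)"
proof -
  obtain p where p: "p \<in> free_lists N" and X: "X = ext_cong N sg `` {p}"
    using X by (rule ext_powerE)
  let ?K = "Poly_Mapping.keys p" and ?c = "Poly_Mapping.lookup p"
  have "(\<Sum>i<N. rho (ys[i := ad_ext sg br X (ys ! i)]) v)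
      = (\<Sum>i<N. \<Sum>xs\<in>?K. sv (?c xs) (rho (ys[i := br (xs @ [ys ! i])]) v))"
    unfolding X ad_ext_class[OF p] free_lift_def
    by (intro sum.cong refl)
      (simp add: linear_simps(5,6)[OF alternating_multilinearD(1)[OF rho_alternating ys]])
  also have "\<dots> = (\<Sum>xs\<in>?K. sv (?c xs) (\<Sum>i<N. rho (ys[i := br (xs @ [ys ! i])]) v))"
    unfolding V.scale_sum_right by (rule sum.swap)
  also have "\<dots> = (\<Sum>xs\<in>?K. sv (?c xs) (rho xs (rho ys v)) - sv (?c xs) (rho ys (rho xs v)))"
    using p ys by (intro sum.cong refl)
      (simp add: rho_commutator[symmetric] free_lists_def V.scale_right_diff_distrib)
  also have "\<dots> = rho_ext sv rho X (rho ys v) - rho ys (rho_ext sv rho X v)"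
    unfolding X rho_ext_class[OF p] free_lift_def
    by (simp add: sum_subtractf linear_simps(5,6)[OF rho_linear[OF ys]])
  finally show ?thesis by simp
qed

lemma deformation_equiv_via_iff:
  assumes X: "X \<in> ext_power N sg"
  shows "deformation_equiv_via (Suc N) sg sv br rho T X T1 T1'
    \<longleftrightarrow> (\<forall>v. T1 v - T1' v = - d0 sg sv br rho T X v)"
proof -
  let ?phi = "dual_map id (ad_ext sg br X)" and ?psi = "dual_map id (rho_ext sv rho X)"
  have phi: "(?phi \<circ> dual_const) x = (x, ad_ext sg br X x)" for x
    by (simp add: dual_map_def dual_const_def)
  have i: "dual_multi br (map (?phi \<circ> dual_const) xs) = ?phi (dual_const (br xs))"
    if "length xs = Suc N" for xs
  proof -
    have "dual_multi br (map (?phi \<circ> dual_const) xs)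
        = (br xs, \<Sum>i<Suc N. br (xs[i := ad_ext sg br X (xs ! i)]))"
      using that by (auto simp: dual_multi_def phi o_def dual_map_def dual_const_def
          simp del: sum.lessThan_Suc intro!: sum.cong)
    then show ?thesis
      using ad_ext_derivation[OF X that] phi[of "br xs"] by (simp del: sum.lessThan_Suc)
  qed
  have ii: "?psi (dual_const (rho xs u))
      = dual_action rho (map (?phi \<circ> dual_const) xs) (?psi (dual_const u))"
    if "length xs = N" for xs u
    using that rho_ext_commutator[OF X that, of u]
    by (auto simp: dual_action_def o_def dual_map_def dual_const_def intro!: sum.cong)
  have iii: "dual_map T T1 \<circ> ?psi = ?phi \<circ> dual_map T T1'
      \<longleftrightarrow> (\<forall>v. T1 v - T1' v = - d0 sg sv br rho T X v)"
  proof -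
    have "dual_map T T1 (?psi (a, b)) = ?phi (dual_map T T1' (a, b))
        \<longleftrightarrow> T1 a - T1' a = - d0 sg sv br rho T X a" for a b
      by (auto simp: dual_map_def d0_def T_simps algebra_simps)
    then show ?thesis by (auto simp: fun_eq_iff)
  qed
  show ?thesis
    unfolding deformation_equiv_via_def Let_def iii using i ii by auto
qed

lemma d0_class:
  "p \<in> free_lists N \<Longrightarrow> d0 sg sv br rho T (ext_cong N sg `` {p})
    = (\<lambda>v. T (free_lift sv (\<lambda>xs. rho xs v) p) - free_lift sg (\<lambda>xs. br (xs @ [T v])) p)"
  by (simp add: fun_eq_iff d0_def ad_ext_class rho_ext_class)

lemmas free_lift_simps =
  linear_simps[OF linear_free_lift[OF G.vector_space_axioms]]
  linear_simps[OF linear_free_lift[OF V.vector_space_axioms]]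

lemma coboundaries1_eq:
  "coboundaries1 (Suc N) sg sv br rho T
    = {d0 sg sv br rho T (ext_cong N sg `` {p}) | p. p \<in> free_lists N}"
  unfolding coboundaries1_def by (auto elim!: ext_powerE intro: ext_power_class)

lemma coboundaries1_zero: "(\<lambda>v. 0) \<in> coboundaries1 (Suc N) sg sv br rho T"
  unfolding coboundaries1_eq
  by (auto simp: d0_class free_lists_closed free_lift_simps T_simps intro!: exI[of _ 0])

lemma coboundaries1_uminus:
  assumes "f \<in> coboundaries1 (Suc N) sg sv br rho T"
  shows "(\<lambda>v. - f v) \<in> coboundaries1 (Suc N) sg sv br rho T"
proof -
  obtain p where p: "p \<in> free_lists N" "f = d0 sg sv br rho T (ext_cong N sg `` {p})"
    using assms unfolding coboundaries1_eq by auto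
  then have "(\<lambda>v. - f v) = d0 sg sv br rho T (ext_cong N sg `` {- p})"
    by (simp add: d0_class free_lists_closed free_lift_simps T_simps)
  then show ?thesis using p unfolding coboundaries1_eq by (blast intro: free_lists_closed)
qed

lemma coboundaries1_add:
  assumes "f \<in> coboundaries1 (Suc N) sg sv br rho T" "g \<in> coboundaries1 (Suc N) sg sv br rho T"
  shows "(\<lambda>v. f v + g v) \<in> coboundaries1 (Suc N) sg sv br rho T"
proof -
  obtain p q where p: "p \<in> free_lists N" "f = d0 sg sv br rho T (ext_cong N sg `` {p})"
    and q: "q \<in> free_lists N" "g = d0 sg sv br rho T (ext_cong N sg `` {q})"
    using assms unfolding coboundaries1_eq by auto
  then have "(\<lambda>v. f v + g v) = d0 sg sv br rho T (ext_cong N sg `` {p + q})"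
    by (simp add: d0_class free_lists_closed free_lift_simps T_simps algebra_simps)
  then show ?thesis using p q unfolding coboundaries1_eq by (blast intro: free_lists_closed)
qed

lemma equiv_cohomologous1:
  "equiv (cocycles1 (Suc N) sg sv br rho T) (cohomologous1 (Suc N) sg sv br rho T)"
proof (rule equivI)
  show "cohomologous1 (Suc N) sg sv br rho T
      \<subseteq> cocycles1 (Suc N) sg sv br rho T \<times> cocycles1 (Suc N) sg sv br rho T"
    by (auto simp: cohomologous1_def)
  show "refl_on (cocycles1 (Suc N) sg sv br rho T) (cohomologous1 (Suc N) sg sv br rho T)"
    by (auto simp: refl_on_def cohomologous1_def coboundaries1_zero)
  show "sym (cohomologous1 (Suc N) sg sv br rho T)"
  proof (rule symI)
    fix f g assume "(f, g) \<in> cohomologous1 (Suc N) sg sv br rho T"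
    then show "(g, f) \<in> cohomologous1 (Suc N) sg sv br rho T"
      using coboundaries1_uminus[of "\<lambda>v. f v - g v"] by (simp add: cohomologous1_def)
  qed
  show "trans (cohomologous1 (Suc N) sg sv br rho T)"
  proof (rule transI)
    fix f g h
    assume "(f, g) \<in> cohomologous1 (Suc N) sg sv br rho T" "(g, h) \<in> cohomologous1 (Suc N) sg sv br rho T"
    then show "(f, h) \<in> cohomologous1 (Suc N) sg sv br rho T"
      using coboundaries1_add[of "\<lambda>v. f v - g v" "\<lambda>v. g v - h v"] by (simp add: cohomologous1_def)
  qed
qed

lemma deformation_equiv_eq_cohomologous1:
  "deformation_equiv (Suc N) sg sv br rho T = cohomologous1 (Suc N) sg sv br rho T"
proof -
  have "(\<exists>X\<in>ext_power N sg. deformation_equiv_via (Suc N) sg sv br rho T X f g)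
      \<longleftrightarrow> (\<lambda>v. f v - g v) \<in> coboundaries1 (Suc N) sg sv br rho T" for f g
  proof -
    have "(\<exists>X\<in>ext_power N sg. deformation_equiv_via (Suc N) sg sv br rho T X f g)
        \<longleftrightarrow> (\<exists>X\<in>ext_power N sg. \<forall>v. g v - f v = d0 sg sv br rho T X v)"
    proof (intro bex_cong refl)
      fix X assume "X \<in> ext_power N sg"
      moreover have "a - b = - c \<longleftrightarrow> b - a = c" for a b c :: 'g
        by (metis minus_diff_eq minus_minus)
      ultimately show "deformation_equiv_via (Suc N) sg sv br rho T X f g
          \<longleftrightarrow> (\<forall>v. g v - f v = d0 sg sv br rho T X v)"
        by (simp add: deformation_equiv_via_iff)
    qed
    also have "\<dots> \<longleftrightarrow> (\<lambda>v. g v - f v) \<in> coboundaries1 (Suc N) sg sv br rho T"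
      by (auto simp: coboundaries1_def image_iff fun_eq_iff)
    also have "\<dots> \<longleftrightarrow> (\<lambda>v. f v - g v) \<in> coboundaries1 (Suc N) sg sv br rho T"
      using coboundaries1_uminus[of "\<lambda>v. f v - g v"] coboundaries1_uminus[of "\<lambda>v. g v - f v"]
      by (simp only: minus_diff_eq) blast
    finally show ?thesis .
  qed
  then show ?thesis
    by (simp add: deformation_equiv_def cohomologous1_def infinitesimal_deformations_eq_cocycles1)
qed

end


section \<open>The correspondence\<close>

theorem theorem5p3:
  fixes n :: nat
    and sg :: "'k::{alg_closed_field, field_char_0} \<Rightarrow> 'g::ab_group_add \<Rightarrow> 'g"
    and sv :: "'k \<Rightarrow> 'v::ab_group_add \<Rightarrow> 'v"
    and br :: "'g list \<Rightarrow> 'g"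
    and rho :: "'g list \<Rightarrow> 'v \<Rightarrow> 'v"
    and T :: "'v \<Rightarrow> 'g"
  assumes "n \<ge> 2"
    and "fin_dim_vector_space sg"
    and "fin_dim_vector_space sv"
    and "n_lie_rep_pair n sg sv br rho"
    and "relative_rota_baxter n sg sv br rho T"
  shows "equiv (infinitesimal_deformations n sg sv br rho T) (deformation_equiv n sg sv br rho T) \<and>
    (\<exists>\<Phi>. bij_betw \<Phi>
           (infinitesimal_deformations n sg sv br rho T // deformation_equiv n sg sv br rho T)
           (H1 n sg sv br rho T) \<and>
         (\<forall>T1 \<in> infinitesimal_deformations n sg sv br rho T.
            \<Phi> (deformation_equiv n sg sv br rho T `` {T1}) = cohomologous1 n sg sv br rho T `` {T1}))"
proof -
  define N where "N = n - 1"
  have n: "n = Suc N" using assms(1) by (auto simp: N_def)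
  have "vector_space sg" "vector_space sv"
    using assms(2,3) unfolding fin_dim_vector_space_def
    by (auto intro: finite_dimensional_vector_space.axioms(1))
  then interpret rota_baxter_operator sg sv N br rho T
    using assms(4,5) n by (simp add: rota_baxter_operator_def rota_baxter_operator_axioms_def)
  show ?thesis
    unfolding n infinitesimal_deformations_eq_cocycles1 deformation_equiv_eq_cohomologous1 H1_def
    by (intro conjI equiv_cohomologous1 exI[of _ id]) auto
qed

end
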